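(* The usual stochastic order $\leq_{st}$ on real-valued random variables is additive and multiplicative. That is, let $X, Y, Z$ be real-valued random variables such that $Z$ is independent of $X$ and $Z$ is independent of $Y$, and suppose $X \leq_{st} Y$. Then: (i) $X+Z \leq_{st} Y+Z$; (ii) if moreover $Z>0$ (almost surely), then $XZ \leq_{st} YZ$.
   Context: For real-valued random variables $X,Y$ with cumulative distribution functions $F_X(t)=P(X\le t)$ and $F_Y(t)=P(Y\le t)$, one writes $X\leq_{st}Y$ ($X$ is less than or equal to $Y$ in the usual stochastic order) if $F_X(t)\geq F_Y(t)$ for all $t\in\mathbb{R}$. An order on real-valued random variables is called additive if adding a fixed random variable $Z$ to both sides preserves the order, and multiplicative if multiplying both sides by a fixed positive random variable $Z$ preserves the order; throughout, $Z$ is assumed independent of $X$ and of $Y$. *)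

theory Defs
  imports "HOL-Probability.Probability"
begin

definition st_le :: "'a measure \<Rightarrow> ('a \<Rightarrow> real) \<Rightarrow> ('a \<Rightarrow> real) \<Rightarrow> bool" where
  "st_le M X Y \<longleftrightarrow> (\<forall>t. cdf (distr M borel X) t \<ge> cdf (distr M borel Y) t)"

end

theory Submission
  imports Defs
begin

text \<open>
  Condition on \<open>Z = z\<close>: for the operations at hand, the event that \<open>X\<close> combined with \<open>z\<close> is at
  most \<open>t\<close> is a half-line event \<open>X \<le> c\<close> with \<open>c\<close> depending only on \<open>z\<close> and \<open>t\<close>, so its
  probability compares with that for \<open>Y\<close>. By independence, integrating over the law of \<open>Z\<close>
  preserves the inequality.
\<close>

text \<open>Independence makes the joint law of \<open>Z\<close> and \<open>X\<close> the product of
  their laws, so the measure of the preimage of \<open>A\<close> is the integral of its sections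
  over the law of \<open>Z\<close>. This is the conditioning on \<open>Z = z\<close>.\<close>

lemma (in prob_space) emeasure_distr_indep_var:
  assumes ind: "indep_var S Z T X"
    and f: "case_prod f \<in> measurable (S \<Otimes>\<^sub>M T) N" and A: "A \<in> sets N"
  shows "emeasure (distr M N (\<lambda>\<omega>. f (Z \<omega>) (X \<omega>))) A
    = (\<integral>\<^sup>+ z. emeasure (distr M T X) {x \<in> space T. f z x \<in> A} \<partial>distr M S Z)"
proof -
  have Z[measurable]: "Z \<in> measurable M S" and X[measurable]: "X \<in> measurable M T"
    using ind indep_var_rv1 indep_var_rv2 by blast+
  interpret D: prob_space "distr M T X" by (rule prob_space_distr) simp
  let ?B = "case_prod f -` A \<inter> space (S \<Otimes>\<^sub>M T)"
  have B: "?B \<in> sets (S \<Otimes>\<^sub>M T)" using f A by (rule measurable_sets)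
  have "distr M N (\<lambda>\<omega>. f (Z \<omega>) (X \<omega>)) = distr (distr M (S \<Otimes>\<^sub>M T) (\<lambda>\<omega>. (Z \<omega>, X \<omega>))) N (case_prod f)"
    using f by (subst distr_distr) (auto simp: comp_def)
  also have "\<dots> = distr (distr M S Z \<Otimes>\<^sub>M distr M T X) N (case_prod f)"
    using ind by (simp add: indep_var_distribution_eq)
  finally have "emeasure (distr M N (\<lambda>\<omega>. f (Z \<omega>) (X \<omega>))) A
      = emeasure (distr M S Z \<Otimes>\<^sub>M distr M T X) ?B"
    using f A by (simp add: emeasure_distr space_pair_measure cong: measurable_cong_sets)
  also have "\<dots> = (\<integral>\<^sup>+ z. emeasure (distr M T X) (Pair z -` ?B) \<partial>distr M S Z)"
    using B by (intro D.emeasure_pair_measure_alt) simp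
  \<comment> \<open>The integral only sees \<open>z\<close> in \<open>space S\<close>, and for such
    \<open>z\<close> the section of \<open>?B\<close> is exactly the displayed set.\<close>
  also have "\<dots> = (\<integral>\<^sup>+ z. emeasure (distr M T X) {x \<in> space T. f z x \<in> A} \<partial>distr M S Z)"
    by (intro nn_integral_cong arg_cong2[where f = emeasure]) (auto simp: space_pair_measure)
  finally show ?thesis .
qed

text \<open>Both laws are finite, so the real inequality between the cdfs can be read in
  \<open>ennreal\<close>. There the sections are compared by monotonicity of the nonnegative
  integral, with no integrability to check.\<close>

lemma (in prob_space) st_le_iff_emeasure:
  assumes "X \<in> borel_measurable M" "Y \<in> borel_measurable M"
  shows "st_le M X Y \<longleftrightarrow>
    (\<forall>t. emeasure (distr M borel Y) {..t} \<le> emeasure (distr M borel X) {..t})"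
proof -
  interpret X: prob_space "distr M borel X" using assms(1) by (rule prob_space_distr)
  interpret Y: prob_space "distr M borel Y" using assms(2) by (rule prob_space_distr)
  show ?thesis
    by (simp add: st_le_def cdf_def X.emeasure_eq_measure Y.emeasure_eq_measure)
qed

text \<open>Common core of the sum and the product. The ray condition is asked only almost
  everywhere under the law of \<open>Z\<close>, since positivity of a factor is known only almost
  surely.\<close>

lemma (in prob_space) st_le_combine:
  fixes X Y :: "'a \<Rightarrow> real" and f :: "real \<Rightarrow> real \<Rightarrow> real"
  assumes "indep_var S Z borel X" "indep_var S Z borel Y" and le: "st_le M X Y"
    and f[measurable]: "case_prod f \<in> borel_measurable (S \<Otimes>\<^sub>M borel)"
    and ray: "AE z in distr M S Z. \<forall>t. \<exists>c. {x. f z x \<le> t} = {..c}"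
  shows "st_le M (\<lambda>\<omega>. f (Z \<omega>) (X \<omega>)) (\<lambda>\<omega>. f (Z \<omega>) (Y \<omega>))"
proof -
  have [measurable]: "Z \<in> measurable M S" "X \<in> borel_measurable M" "Y \<in> borel_measurable M"
    using assms(1,2) indep_var_rv1 indep_var_rv2 by blast+
  have *: "emeasure (distr M borel Y) {..c} \<le> emeasure (distr M borel X) {..c}" for c
    using le by (simp add: st_le_iff_emeasure)
  have "(\<integral>\<^sup>+ z. emeasure (distr M borel Y) {x. f z x \<le> t} \<partial>distr M S Z)
      \<le> (\<integral>\<^sup>+ z. emeasure (distr M borel X) {x. f z x \<le> t} \<partial>distr M S Z)" for t
    \<comment> \<open>The endpoint \<open>c\<close> varies with \<open>z\<close> and
      \<open>t\<close> but is the same for both integrands, so \<open>*\<close> compares them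
      pointwise.\<close>
    using ray by (intro nn_integral_mono_AE) (auto elim!: eventually_mono, metis *)
  moreover have "(\<lambda>\<omega>. f (Z \<omega>) (X \<omega>)) \<in> borel_measurable M" "(\<lambda>\<omega>. f (Z \<omega>) (Y \<omega>)) \<in> borel_measurable M"
    by measurable
  ultimately show ?thesis
    using emeasure_distr_indep_var[OF assms(1) f] emeasure_distr_indep_var[OF assms(2) f]
    by (simp add: st_le_iff_emeasure)
qed

theorem theorem3p1:
  fixes M :: "'a measure" and X Y Z :: "'a \<Rightarrow> real"
  assumes "prob_space M"
    and "X \<in> borel_measurable M" and "Y \<in> borel_measurable M" and "Z \<in> borel_measurable M"
    and "prob_space.indep_var M borel Z borel X"
    and "prob_space.indep_var M borel Z borel Y"
    and "st_le M X Y"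
  shows "st_le M (\<lambda>\<omega>. X \<omega> + Z \<omega>) (\<lambda>\<omega>. Y \<omega> + Z \<omega>)
    \<and> ((AE \<omega> in M. Z \<omega> > 0) \<longrightarrow> st_le M (\<lambda>\<omega>. X \<omega> * Z \<omega>) (\<lambda>\<omega>. Y \<omega> * Z \<omega>))"
proof (intro conjI impI)
  interpret prob_space M by fact
  note combine = st_le_combine[OF assms(5-7)]
  have "{x. x + z \<le> t} = {..t - z}" for z t :: real by auto
  then show "st_le M (\<lambda>\<omega>. X \<omega> + Z \<omega>) (\<lambda>\<omega>. Y \<omega> + Z \<omega>)"
    by (intro combine[where f = "\<lambda>z x. x + z"]) auto
  assume "AE \<omega> in M. Z \<omega> > 0"
  then have "AE z in distr M borel Z. z > 0"
    using assms(4) by (subst AE_distr_iff) auto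
  \<comment> \<open>Positivity is essential here: for \<open>z < 0\<close> the set is an upper ray,
    and for \<open>z = 0\<close> it is empty or the whole line.\<close>
  moreover have "{x. x * z \<le> t} = {..t / z}" if "z > 0" for z t :: real
    using that by (auto simp: pos_le_divide_eq)
  ultimately have "AE z in distr M borel Z. \<forall>t. \<exists>c. {x. x * z \<le> t} = {..c}"
    by (auto elim!: eventually_mono)
  then show "st_le M (\<lambda>\<omega>. X \<omega> * Z \<omega>) (\<lambda>\<omega>. Y \<omega> * Z \<omega>)"
    by (intro combine[where f = "\<lambda>z x. x * z"]) auto
qed

end
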